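(* Let $m\in\mathbb{N}$, $k\in\mathbb{N}\setminus\{1\}$ and $a\in\mathbb{C}\setminus\{-1,-2,\ldots\}$. Then $$\sum_{n=1}^\infty\frac{H_n^{(m)}}{\binom{n+k+a}{k}}=k\sum_{r=1}^{k-1}(-1)^{r+1}\binom{k-1}{r}\left\{\begin{aligned}&\sum_{i=1}^{m-1}\frac{(-1)^{i-1}}{(a+1)^i}\zeta(m+1-i)-(-1)^m\frac{H_{a+1}}{(a+1)^m}\\&+(-1)^{m-1}\sum_{i=1}^{r-1}\frac{H_i^{(1)}(a+1)}{(i+a+1)^m}+(-1)^{m-1}H_{a+1}H_{r-1}^{(m)}(a+1)\\&+\sum_{j=1}^{m-1}(-1)^{j-1}\zeta(m+1-j)H_{r-1}^{(j)}(a+1)\end{aligned}\right\}.$$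
   Context: $\mathbb{N}=\{1,2,3,\ldots\}$. For $n\in\mathbb{N}$, $H_n^{(m)}=\sum_{j=1}^n j^{-m}$. For $\alpha\in\mathbb{C}\setminus\{-1,-2,\ldots\}$, $H_\alpha=\psi(\alpha+1)+\gamma=\sum_{l=1}^\infty\left(\frac1l-\frac1{l+\alpha}\right)$ is the shifted harmonic number ($\psi$ the digamma function, $\gamma$ the Euler–Mascheroni constant). The parametric harmonic numbers are $H_n^{(s)}(c)=\sum_{j=1}^n (j+c)^{-s}$ for $n\ge 0$, $c\in\mathbb{C}\setminus\{-1,-2,\ldots\}$, so $H_0^{(s)}(c)=0$. $\zeta$ is the Riemann zeta function. For $u\in\mathbb{C}$ and $k\in\mathbb{N}$, $\binom{u}{k}=\frac{u(u-1)\cdots(u-k+1)}{k!}$. Empty sums are $0$. *)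

theory Defs
  imports "HOL-Analysis.Analysis"
begin

text \<open>The Dirichlet series represents the Riemann zeta function only for \<open>Re s > 1\<close>; elsewhere
  the value below is meaningless.\<close>

definition zeta :: "complex \<Rightarrow> complex" where
  "zeta s = (\<Sum>n. 1 / of_nat (Suc n) powr s)"

definition gen_harmonic :: "nat \<Rightarrow> nat \<Rightarrow> complex" where
  "gen_harmonic n m = (\<Sum>j=1..n. 1 / of_nat j ^ m)"

text \<open>Meaningful for \<open>\<alpha>\<close> not a negative integer.\<close>

definition shifted_harmonic :: "complex \<Rightarrow> complex" where
  "shifted_harmonic \<alpha> = Digamma (\<alpha> + 1) + euler_mascheroni"

text \<open>\<open>param_harmonic n s c\<close> is $H_n^{(s)}(c)$, for \<open>c\<close> not a negative integer; only natural
  orders \<open>s\<close> are needed.\<close>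

definition param_harmonic :: "nat \<Rightarrow> nat \<Rightarrow> complex \<Rightarrow> complex" where
  "param_harmonic n s c = (\<Sum>j=1..n. 1 / (of_nat j + c) ^ s)"

end

theory Submission
  imports Defs "HOL-Real_Asymp.Real_Asymp"
begin

text \<open>
  Write $N$ for the summation index and $b = a + 1$. Partial fractions in $N$ turn
  $1/\binom{N+k+a}{k}$ into the alternating sum
  $k \sum_{r<k} (-1)^r \binom{k-1}{r} / (N+b+r)$. Each of these terms alone would lead to a
  divergent series, but the coefficients add up to zero since $k \ge 2$, so that $1/(N+b)$ may be
  subtracted from every $1/(N+b+r)$; this is where the sum over $r \ge 1$ with sign $(-1)^{r+1}$
  comes from.

  It remains to evaluate $\sum_N H_N^{(m)} (1/(N+b) - 1/(N+b+r))$. The difference is a sum of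
  unit steps $1/(N+c) - 1/(N+c+1)$ with $c = b+s$, $s < r$. For one unit step, summation by parts
  replaces $H_N^{(m)}$ by its increment $1/N^m$ (lemma \<open>gen_harmonic_unit_step_sums\<close>); the
  boundary term vanishes because $H_N^{(m)}$ grows at most logarithmically. What is left,
  $\sum_N 1/(N^m (N+c))$, is evaluated by partial fractions once more, one power of $N$ at a time
  (lemma \<open>power_linear_sums\<close>): every power contributes a zeta value and the last step contributes
  the shifted harmonic number $H_c$. The recurrence $H_{b+s} = H_b + H_s^{(1)}(b)$ finally
  expresses the numbers $H_c$ through $H_b$.
\<close>

section \<open>Harmonic numbers and zeta values\<close>

lemma gen_harmonic_Suc: "gen_harmonic (Suc n) m = gen_harmonic n m + 1 / of_nat (Suc n) ^ m"
  by (simp add: gen_harmonic_def)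

lemma norm_gen_harmonic_le:
  assumes "m \<ge> 1"
  shows "norm (gen_harmonic n m) \<le> harm n"
  unfolding gen_harmonic_def harm_def
proof (rule sum_norm_le)
  fix j assume "j \<in> {1..n}"
  then have "real j ^ 1 \<le> real j ^ m" using assms by (intro power_increasing) auto
  with \<open>j \<in> {1..n}\<close> show "norm (1 / of_nat j ^ m :: complex) \<le> inverse (of_nat j)"
    by (simp add: norm_divide norm_power field_simps)
qed

text \<open>The sequence $H_n - \ln n$ converges, so after division by $n$ only $\ln n / n$ matters.\<close>

lemma harm_over_n_tendsto_0: "(\<lambda>n. harm n / real n) \<longlonglongrightarrow> 0"
proof -
  have "(\<lambda>n. (harm n - ln (real n)) * (1 / real n) + ln (real n) / real n)
          \<longlonglongrightarrow> euler_mascheroni * 0 + 0"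
    by (intro tendsto_add tendsto_mult euler_mascheroni_LIMSEQ) real_asymp+
  moreover have "(harm n - ln (real n)) * (1 / real n) + ln (real n) / real n = harm n / real n" for n
    by (simp add: field_simps flip: add_divide_distrib)
  ultimately show ?thesis by simp
qed

lemma gen_harmonic_over_linear_tendsto_0:
  assumes "m \<ge> 1"
  shows "(\<lambda>n. gen_harmonic n m / (of_nat n + c)) \<longlonglongrightarrow> 0"
proof -
  have "(\<lambda>n. gen_harmonic n m / of_nat n) \<longlonglongrightarrow> 0"
  proof (rule Lim_null_comparison[OF always_eventually harm_over_n_tendsto_0], rule allI)
    show "norm (gen_harmonic n m / of_nat n) \<le> harm n / real n" for n
      using norm_gen_harmonic_le[OF assms] by (simp add: norm_divide divide_right_mono)
  qed
  moreover have "(\<lambda>n. 1 / (1 + c / of_nat n)) \<longlonglongrightarrow> 1 / (1 + 0)"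
    by (intro tendsto_intros lim_const_over_n) auto
  ultimately have "(\<lambda>n. gen_harmonic n m / of_nat n * (1 / (1 + c / of_nat n))) \<longlonglongrightarrow> 0 * (1 / (1 + 0))"
    by (rule tendsto_mult)
  moreover have "eventually (\<lambda>n. gen_harmonic n m / of_nat n * (1 / (1 + c / of_nat n)) =
                    gen_harmonic n m / (of_nat n + c)) sequentially"
    using eventually_gt_at_top[of 0] by eventually_elim (simp add: distrib_left)
  ultimately show ?thesis by (subst (asm) tendsto_cong) auto
qed

lemma zeta_nat_sums:
  assumes "q \<ge> 2"
  shows "(\<lambda>n. 1 / of_nat (Suc n) ^ q) sums zeta (of_nat q)"
proof -
  have "summable (\<lambda>n. 1 / of_nat (Suc n) ^ q :: complex)"
    using inverse_power_summable[OF assms, where 'a = complex]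
    by (subst (asm) summable_Suc_iff[symmetric]) (simp add: inverse_eq_divide)
  moreover have "of_nat (Suc n) powr of_nat q = (of_nat (Suc n) ^ q :: complex)" for n
    using assms by (intro powr_nat') simp
  ultimately show ?thesis by (simp add: zeta_def summable_sums)
qed

lemma shifted_harmonic_sums:
  assumes "c \<noteq> - 1"
  shows "(\<lambda>n. 1 / of_nat (Suc n) - 1 / (of_nat (Suc n) + c)) sums shifted_harmonic c"
proof -
  have "c + 1 \<noteq> 0" using assms by (simp add: eq_neg_iff_add_eq_0)
  from summable_sums[OF summable_Digamma[OF this]] show ?thesis
    by (simp add: shifted_harmonic_def Digamma_def inverse_eq_divide add_ac)
qed

lemma shifted_harmonic_add_nat:
  assumes "c + 1 \<notin> \<int>\<^sub>\<le>\<^sub>0"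
  shows "shifted_harmonic (of_nat s + c) = shifted_harmonic c + param_harmonic s 1 c"
proof (induction s)
  case (Suc s)
  have "of_nat s + (c + 1) \<noteq> 0"
    using assms plus_of_nat_eq_0_imp[of "c + 1" s] by (auto simp: add.commute)
  from Digamma_plus1[OF this] show ?case
    using Suc by (simp add: shifted_harmonic_def param_harmonic_def add_ac)
qed (simp add: param_harmonic_def)

section \<open>The series of reciprocals of a power times a linear factor\<close>

text \<open>The closed form of $\sum_{N \ge 1} 1/(N^m (N+c))$.\<close>

definition power_linear_sum :: "nat \<Rightarrow> complex \<Rightarrow> complex" where
  "power_linear_sum m c = (\<Sum>i=1..m-1. (-1) ^ (i - 1) / c ^ i * zeta (of_nat (m + 1 - i)))
     + (-1) ^ (m - 1) * (shifted_harmonic c / c ^ m)"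

lemma power_linear_sum_Suc_0: "power_linear_sum (Suc 0) c = shifted_harmonic c / c"
  by (simp add: power_linear_sum_def)

lemma power_linear_sum_Suc:
  assumes "m \<ge> 1"
  shows "power_linear_sum (Suc m) c = (zeta (of_nat (Suc m)) - power_linear_sum m c) / c"
proof -
  from assms obtain l where m: "m = Suc l" by (cases m) auto
  have "(\<Sum>i=1..Suc l. (-1) ^ (i - 1) / c ^ i * zeta (of_nat (Suc (Suc l) + 1 - i))) =
        zeta (of_nat (Suc m)) / c + (\<Sum>i=1..l. (-1) ^ i / c ^ Suc i * zeta (of_nat (m + 1 - i)))"
    by (subst sum.atLeast_Suc_atMost, simp, subst sum.shift_bounds_cl_Suc_ivl) (simp add: m)
  also have "(\<Sum>i=1..l. (-1) ^ i / c ^ Suc i * zeta (of_nat (m + 1 - i))) =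
        - (\<Sum>i=1..l. (-1) ^ (i - 1) / c ^ i * zeta (of_nat (m + 1 - i))) / c"
    unfolding sum_negf[symmetric] sum_divide_distrib
  proof (rule sum.cong)
    fix i assume "i \<in> {1..l}"
    then obtain j where "i = Suc j" by (cases i) auto
    then show "(-1) ^ i / c ^ Suc i * zeta (of_nat (m + 1 - i)) =
        - ((-1) ^ (i - 1) / c ^ i * zeta (of_nat (m + 1 - i))) / c" by simp
  qed simp
  finally show ?thesis
    by (simp add: power_linear_sum_def m diff_divide_distrib add_divide_distrib)
qed

text \<open>Partial fractions in $N$ for one power of $N$: the numerator $c$ is written as
  $(N + c) - N$.\<close>

lemma reciprocal_power_linear_split:
  fixes c :: "'a :: field_char_0"
  assumes "c \<notin> \<int>\<^sub>\<le>\<^sub>0"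
  shows "1 / (of_nat (Suc n) ^ Suc m * (of_nat (Suc n) + c)) =
    (1 / of_nat (Suc n) ^ Suc m - 1 / (of_nat (Suc n) ^ m * (of_nat (Suc n) + c))) / c"
proof -
  define x :: 'a where "x = of_nat (Suc n)"
  have "c \<noteq> 0" "x \<noteq> 0" "x + c \<noteq> 0"
    using assms plus_of_nat_eq_0_imp[of c "Suc n"] of_nat_neq_0 unfolding x_def
    by (auto simp: add.commute simp del: of_nat_Suc)
  then show ?thesis
    unfolding x_def[symmetric] by (simp add: divide_simps)
qed

text \<open>Induction on \<open>m\<close>: the splitting above turns the series for $m+1$ into a zeta series minus the
  series for $m$, and the one for $m = 1$ into the series of the shifted harmonic number.\<close>

lemma power_linear_sums:
  assumes "c \<notin> \<int>\<^sub>\<le>\<^sub>0" and "m \<ge> 1"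
  shows "(\<lambda>n. 1 / (of_nat (Suc n) ^ m * (of_nat (Suc n) + c))) sums power_linear_sum m c"
  using \<open>m \<ge> 1\<close>
proof (induction m rule: dec_induct)
  case base
  have "c \<noteq> - 1" using assms(1) by auto
  from sums_divide[OF shifted_harmonic_sums[OF this], of c] show ?case
    using reciprocal_power_linear_split[OF assms(1), of _ 0] by (simp add: power_linear_sum_Suc_0)
next
  case (step m)
  have "Suc m \<ge> 2" using step by simp
  from sums_divide[OF sums_diff[OF zeta_nat_sums[OF this] step.IH], of c] show ?case
    unfolding reciprocal_power_linear_split[OF assms(1)] power_linear_sum_Suc[OF step.hyps(1)] .
qed

section \<open>Telescoping series weighted by harmonic numbers\<close>

text \<open>Summation by parts, written as a termwise identity: $H_N^{(m)} = H_{N-1}^{(m)} + 1/N^m$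
  splits the summand into $1/(N^m (N+c))$ and the difference of consecutive terms of
  $H_{N-1}^{(m)}/(N+c)$, which telescopes to $0$ since $H_0^{(m)} = 0$ and the terms tend to $0$.\<close>

lemma gen_harmonic_unit_step_sums:
  assumes "c \<notin> \<int>\<^sub>\<le>\<^sub>0" and "m \<ge> 1"
  shows "(\<lambda>n. gen_harmonic (Suc n) m * (1 / (of_nat (Suc n) + c) - 1 / (of_nat (Suc n) + (c + 1))))
           sums power_linear_sum m c"
proof -
  define f where "f n = gen_harmonic n m / (of_nat n + (c + 1))" for n
  have "(\<lambda>n. f n - f (Suc n)) sums (f 0 - 0)"
    unfolding f_def by (intro telescope_sums' gen_harmonic_over_linear_tendsto_0 assms)
  then have "(\<lambda>n. f n - f (Suc n)) sums 0" by (simp add: f_def gen_harmonic_def)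
  from sums_add[OF power_linear_sums[OF assms] this]
  have "(\<lambda>n. 1 / (of_nat (Suc n) ^ m * (of_nat (Suc n) + c)) + (f n - f (Suc n)))
          sums power_linear_sum m c" by simp
  moreover have "1 / (of_nat (Suc n) ^ m * (of_nat (Suc n) + c)) + (f n - f (Suc n)) =
      gen_harmonic (Suc n) m * (1 / (of_nat (Suc n) + c) - 1 / (of_nat (Suc n) + (c + 1)))" for n
  proof -
    have "of_nat n + (c + 1) = of_nat (Suc n) + c" by simp
    then show ?thesis
      unfolding f_def right_diff_distrib by (simp add: gen_harmonic_Suc add_divide_distrib)
  qed
  ultimately show ?thesis by simp
qed

lemma gen_harmonic_shift_sums:
  assumes "b \<notin> \<int>\<^sub>\<le>\<^sub>0" and "m \<ge> 1"
  shows "(\<lambda>n. gen_harmonic (Suc n) m * (1 / (of_nat (Suc n) + b) - 1 / (of_nat (Suc n) + (of_nat r + b))))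
           sums (\<Sum>s<r. power_linear_sum m (of_nat s + b))"
proof (induction r)
  case (Suc r)
  have "of_nat r + b \<notin> \<int>\<^sub>\<le>\<^sub>0"
    using nonpos_Ints_diff_Nats[of "of_nat r + b" "of_nat r"] assms(1) by auto
  from sums_add[OF Suc gen_harmonic_unit_step_sums[OF this assms(2)]] show ?case
    by (simp add: algebra_simps)
qed simp

text \<open>The term $s = 0$ gives the first two summands of the right-hand side. In the terms
  $s \ge 1$ the recurrence $H_{b+s} = H_b + H_s^{(1)}(b)$ separates the nested harmonic sum from
  the multiple of $H_b$, and exchanging the sums over $s$ and $j$ collects the factors of each
  zeta value.\<close>

lemma sum_power_linear_sum:
  assumes "b + 1 \<notin> \<int>\<^sub>\<le>\<^sub>0" and "m \<ge> 1" and "r \<ge> 1"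
  shows "(\<Sum>s<r. power_linear_sum m (of_nat s + b)) =
    (\<Sum>i=1..m-1. (-1) ^ (i - 1) / b ^ i * zeta (of_nat (m + 1 - i)))
    - (-1) ^ m * (shifted_harmonic b / b ^ m)
    + (-1) ^ (m - 1) * (\<Sum>i=1..r-1. param_harmonic i 1 b / (of_nat i + b) ^ m)
    + (-1) ^ (m - 1) * shifted_harmonic b * param_harmonic (r - 1) m b
    + (\<Sum>j=1..m-1. (-1) ^ (j - 1) * zeta (of_nat (m + 1 - j)) * param_harmonic (r - 1) j b)"
proof -
  have r: "{..<r} = insert 0 {1..r-1}" using \<open>r \<ge> 1\<close> by auto
  have sgn: "(-1 :: complex) ^ m = - ((-1) ^ (m - 1))" using \<open>m \<ge> 1\<close> by (cases m) auto
  have "(\<Sum>s=1..r-1. power_linear_sum m (of_nat s + b)) =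
      (\<Sum>s=1..r-1. \<Sum>j=1..m-1. (-1) ^ (j - 1) * zeta (of_nat (m + 1 - j)) * (1 / (of_nat s + b) ^ j)) +
      (\<Sum>s=1..r-1. (-1) ^ (m - 1) * (param_harmonic s 1 b / (of_nat s + b) ^ m)) +
      (\<Sum>s=1..r-1. (-1) ^ (m - 1) * shifted_harmonic b * (1 / (of_nat s + b) ^ m))"
    unfolding sum.distrib[symmetric] power_linear_sum_def shifted_harmonic_add_nat[OF assms(1)]
    by (intro sum.cong refl) (simp add: algebra_simps add_divide_distrib)
  also have "(\<Sum>s=1..r-1. \<Sum>j=1..m-1. (-1) ^ (j - 1) * zeta (of_nat (m + 1 - j)) * (1 / (of_nat s + b) ^ j))
      = (\<Sum>j=1..m-1. (-1) ^ (j - 1) * zeta (of_nat (m + 1 - j)) * param_harmonic (r - 1) j b)"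
    by (subst sum.swap) (simp only: param_harmonic_def sum_distrib_left)
  finally show ?thesis
    unfolding r by (simp add: sgn power_linear_sum_def param_harmonic_def sum_distrib_left)
qed

section \<open>Partial fractions of the reciprocal binomial coefficient\<close>

text \<open>By induction on \<open>k\<close>: Pascal's rule makes the left-hand side for \<open>k + 1\<close> at \<open>x\<close> the difference
  of those for \<open>k\<close> at \<open>x\<close> and at \<open>x + 1\<close>, and the right-hand side satisfies the same recurrence.\<close>

lemma alternating_binomial_reciprocal_sum:
  fixes x :: "'a :: field_char_0"
  assumes "\<And>j. j \<le> k \<Longrightarrow> x + of_nat j \<noteq> 0"
  shows "(\<Sum>r\<le>k. (-1) ^ r * of_nat (k choose r) / (x + of_nat r)) = fact k / pochhammer x (Suc k)"
  using assms
proof (induction k arbitrary: x)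
  case (Suc k)
  let ?t = "\<lambda>k x r. (-1) ^ r * of_nat (k choose r) / (x + of_nat r) :: 'a"
  have nz: "x + of_nat j \<noteq> 0" if "j \<le> Suc k" for j using Suc.prems that .
  have nz': "x + 1 + of_nat j \<noteq> 0" if "j \<le> k" for j using nz[of "Suc j"] that by (simp add: add_ac)
  have "?t (Suc k) x (Suc r) = ?t k x (Suc r) - ?t k (x + 1) r" for r
    by (simp add: ring_distribs add_divide_distrib diff_divide_distrib mult_ac add_ac)
  then have "(\<Sum>r\<le>Suc k. ?t (Suc k) x r) = 1 / x + (\<Sum>r\<le>k. ?t k x (Suc r) - ?t k (x + 1) r)"
    by (subst sum.atMost_Suc_shift) simp
  also have "\<dots> = (\<Sum>r\<le>Suc k. ?t k x r) - (\<Sum>r\<le>k. ?t k (x + 1) r)"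
    by (simp add: sum.atMost_Suc_shift sum_subtractf del: sum.atMost_Suc)
  also have "\<dots> = (\<Sum>r\<le>k. ?t k x r) - (\<Sum>r\<le>k. ?t k (x + 1) r)" by simp
  also have "\<dots> = fact k / pochhammer x (Suc k) - fact k / pochhammer (x + 1) (Suc k)"
    using Suc.IH[of x] Suc.IH[of "x + 1"] nz nz' by simp
  also have "\<dots> = fact (Suc k) / pochhammer x (Suc (Suc k))"
  proof -
    define p where "p = pochhammer (x + 1) k"
    have "p \<noteq> 0"
      using nz' unfolding p_def pochhammer_eq_0_iff by (metis add.commute add.right_inverse less_imp_le)
    have 1: "pochhammer x (Suc k) = x * p" by (simp add: p_def pochhammer_rec)
    have 2: "pochhammer (x + 1) (Suc k) = (x + of_nat (Suc k)) * p"
      by (simp add: p_def pochhammer_rec' add_ac)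
    have 3: "pochhammer x (Suc (Suc k)) = x * ((x + of_nat (Suc k)) * p)"
      by (simp add: pochhammer_rec[of x "Suc k"] 2 del: of_nat_Suc)
    have "x \<noteq> 0" "x + of_nat (Suc k) \<noteq> 0" using nz[of 0] nz[of "Suc k"] by simp_all
    with \<open>p \<noteq> 0\<close> show ?thesis
      unfolding 1 2 3 fact_Suc by (simp add: divide_simps del: of_nat_Suc) (simp add: algebra_simps)
  qed
  finally show ?case .
qed simp

lemma reciprocal_gbinomial_partial_fractions:
  fixes x :: "'a :: field_char_0"
  assumes "k \<ge> 2" and "\<And>j. x + of_nat j \<noteq> 0"
  shows "1 / ((x + of_nat k - 1) gchoose k) =
    of_nat k * (\<Sum>r=1..k-1. (-1) ^ (r + 1) * of_nat ((k - 1) choose r) * (1 / x - 1 / (x + of_nat r)))"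
proof -
  obtain l where k: "k = Suc l" "l > 0" using \<open>k \<ge> 2\<close> by (cases k) auto
  let ?c = "\<lambda>r. (-1) ^ r * of_nat (l choose r) :: 'a"
  have "1 / ((x + of_nat k - 1) gchoose k) = of_nat k * (fact l / pochhammer x (Suc l))"
    by (simp add: gbinomial_pochhammer' k)
  (* The coefficients add up to 0, so 1 / x can be subtracted; the term r = 0 then vanishes. *)
  also have "fact l / pochhammer x (Suc l) = (\<Sum>r\<le>l. ?c r / (x + of_nat r)) - (\<Sum>r\<le>l. ?c r) / x"
    using alternating_binomial_reciprocal_sum[of l x] choose_alternating_sum[OF k(2), where 'a = 'a] assms(2)
    by simp
  also have "\<dots> = (\<Sum>r\<le>l. - ?c r * (1 / x - 1 / (x + of_nat r)))"
    by (simp add: sum_divide_distrib sum_subtractf[symmetric] algebra_simps)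
  also have "\<dots> = (\<Sum>r=1..l. - ?c r * (1 / x - 1 / (x + of_nat r)))"
    by (intro sum.mono_neutral_right) (auto simp: not_le)
  finally show ?thesis by (simp add: k)
qed

section \<open>Evaluation of the series\<close>

theorem theorem4p2:
  fixes m k :: nat and a :: complex
  assumes "m \<ge> 1" and "k \<ge> 2"
    and "\<And>j::nat. j \<ge> 1 \<Longrightarrow> a \<noteq> - of_nat j"
  shows "(\<lambda>n. gen_harmonic (Suc n) m / ((of_nat (Suc n) + of_nat k + a) gchoose k)) sums
    (of_nat k * (\<Sum>r=1..k-1. (-1) ^ (r + 1) * of_nat ((k - 1) choose r) *
      ((\<Sum>i=1..m-1. (-1) ^ (i - 1) / (a + 1) ^ i * zeta (of_nat (m + 1 - i)))
       - (-1) ^ m * (shifted_harmonic (a + 1) / (a + 1) ^ m)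
       + (-1) ^ (m - 1) * (\<Sum>i=1..r-1. param_harmonic i 1 (a + 1) / (of_nat i + a + 1) ^ m)
       + (-1) ^ (m - 1) * shifted_harmonic (a + 1) * param_harmonic (r - 1) m (a + 1)
       + (\<Sum>j=1..m-1. (-1) ^ (j - 1) * zeta (of_nat (m + 1 - j)) * param_harmonic (r - 1) j (a + 1)))))"
proof -
  define b where "b = a + 1"
  have b: "b \<notin> \<int>\<^sub>\<le>\<^sub>0"
  proof
    assume "b \<in> \<int>\<^sub>\<le>\<^sub>0"
    then obtain n where "b = - of_nat n" by (elim nonpos_Ints_cases')
    then have "a = - of_nat (Suc n)" by (simp add: b_def eq_diff_eq[symmetric])
    with assms(3)[of "Suc n"] show False by simp
  qed
  then have b1: "b + 1 \<notin> \<int>\<^sub>\<le>\<^sub>0" using plus_one_in_nonpos_Ints_imp by blast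
  let ?S = "\<lambda>r. \<Sum>s<r. power_linear_sum m (of_nat s + b)"
  let ?w = "\<lambda>r. (-1) ^ (r + 1) * of_nat ((k - 1) choose r) :: complex"
  have "(\<lambda>n. of_nat k * (\<Sum>r=1..k-1. ?w r * (gen_harmonic (Suc n) m *
          (1 / (of_nat (Suc n) + b) - 1 / (of_nat (Suc n) + (of_nat r + b))))))
        sums (of_nat k * (\<Sum>r=1..k-1. ?w r * ?S r))"
    by (intro sums_mult sums_sum gen_harmonic_shift_sums b assms(1))
  also have "(\<lambda>n. of_nat k * (\<Sum>r=1..k-1. ?w r * (gen_harmonic (Suc n) m *
          (1 / (of_nat (Suc n) + b) - 1 / (of_nat (Suc n) + (of_nat r + b)))))) =
        (\<lambda>n. gen_harmonic (Suc n) m / ((of_nat (Suc n) + of_nat k + a) gchoose k))"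
  proof
    fix n
    have nz: "of_nat (Suc n) + b + of_nat j \<noteq> 0" for j
      using plus_of_nat_eq_0_imp[of b "Suc n + j"] b by (auto simp: add_ac)
    have "of_nat (Suc n) + of_nat k + a = of_nat (Suc n) + b + of_nat k - 1" by (simp add: b_def)
    then have "gen_harmonic (Suc n) m / ((of_nat (Suc n) + of_nat k + a) gchoose k) =
        gen_harmonic (Suc n) m * (1 / ((of_nat (Suc n) + b + of_nat k - 1) gchoose k))"
      by (simp only: times_divide_eq_right mult_1_right)
    also have "\<dots> = of_nat k * (\<Sum>r=1..k-1. ?w r * (gen_harmonic (Suc n) m *
          (1 / (of_nat (Suc n) + b) - 1 / (of_nat (Suc n) + (of_nat r + b)))))"
      unfolding reciprocal_gbinomial_partial_fractions[OF assms(2) nz]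
      by (simp add: sum_distrib_left mult_ac add_ac)
    finally show "of_nat k * (\<Sum>r=1..k-1. ?w r * (gen_harmonic (Suc n) m *
          (1 / (of_nat (Suc n) + b) - 1 / (of_nat (Suc n) + (of_nat r + b))))) =
        gen_harmonic (Suc n) m / ((of_nat (Suc n) + of_nat k + a) gchoose k)" ..
  qed
  finally show ?thesis
    using b1 assms(1) by (simp add: sum_power_linear_sum b_def add.assoc cong: sum.cong_simp)
qed

end
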